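(* Let $S=\{a,b\}$ and let $F(S)$ be the free group on $S$. Writing $A=a^{-1}$ and $B=b^{-1}$, let $$r=a\,a\,b\,A\,B\,a\,b\,A\,B\,B\,A\,b\,a\,a\,b\,A\,B\,B\,A\,b,\qquad r'=a\,a\,b\,A\,B\,a\,b\,A\,B\,a\,b\,A\,B\,B\,A\,b\,a\,B\,A\,b .$$ Then $r,r'\in F(S)'\setminus\{e\}$, and both words are cyclically reduced and have length $20$. Moreover, the one-relator groups $G_r=\langle S\mid r\rangle$ and $G_{r'}=\langle S\mid r'\rangle$ are isomorphic, $$G_r\cong G_{r'},$$ while $$\operatorname{scl}_S(r)=1\qquad\text{and}\qquad \operatorname{scl}_S(r')=\frac12 .$$ In particular, it is not true that for all sets $T,T'$ and all $u\in F(T)'\setminus\{e\}$, $u'\in F(T')'\setminus\{e\}$ with $\langle T\mid u\rangle\cong\langle T'\mid u'\rangle$ one has $\operatorname{scl}_T(u)=\operatorname{scl}_{T'}(u')$.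
   Context: For a set $S$, $F(S)$ denotes the free group on $S$, $e$ its identity element, and $F(S)'=[F(S),F(S)]$ its commutator subgroup. For $w\in F(S)'$, the commutator length $\operatorname{cl}_S(w)$ is the least integer $n\ge 0$ such that $w$ is a product of $n$ commutators of elements of $F(S)$, and the stable commutator length is $$\operatorname{scl}_S(w):=\lim_{n\to\infty}\frac{\operatorname{cl}_S(w^n)}{n}.$$ For $r\in F(S)$, $\langle S\mid r\rangle=F(S)/\langle\!\langle r\rangle\!\rangle$, where $\langle\!\langle r\rangle\!\rangle$ is the normal closure of $r$ in $F(S)$; this group is also denoted $G_r$. Capital letters denote inverses of the corresponding generators: $A=a^{-1}$, $B=b^{-1}$. *)

theory Defs
  imports Complex_Main "HOL-Algebra.Generated_Groups"
begin

section \<open>Free groups\<close>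

text \<open>
  The free group on \<open>S\<close> is realised on the freely reduced words in the letters \<open>x\<close> and
  \<open>x\<inverse>\<close> with \<open>x \<in> S\<close>; the product of two words is the free reduction of their concatenation.
\<close>

datatype 'a letter = Gen 'a | Inv 'a

primrec inv_letter :: "'a letter \<Rightarrow> 'a letter" where
  "inv_letter (Gen x) = Inv x"
| "inv_letter (Inv x) = Gen x"

definition reduced :: "'a letter list \<Rightarrow> bool" where
  "reduced w \<longleftrightarrow> successively (\<lambda>x y. y \<noteq> inv_letter x) w"

definition cyclically_reduced :: "'a letter list \<Rightarrow> bool" where
  "cyclically_reduced w \<longleftrightarrow> reduced w \<and> (w \<noteq> [] \<longrightarrow> hd w \<noteq> inv_letter (last w))"

fun cancel_Cons :: "'a letter \<Rightarrow> 'a letter list \<Rightarrow> 'a letter list" where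
  "cancel_Cons x [] = [x]"
| "cancel_Cons x (y # w) = (if y = inv_letter x then w else x # y # w)"

definition reduce :: "'a letter list \<Rightarrow> 'a letter list" where
  "reduce w = foldr cancel_Cons w []"

definition free_group :: "'a set \<Rightarrow> 'a letter list monoid" where
  "free_group S =
     \<lparr>carrier = {w \<in> lists (Gen ` S \<union> Inv ` S). reduced w},
      monoid.mult = (\<lambda>u v. reduce (u @ v)),
      monoid.one = []\<rparr>"

lemma inv_letter_inv_letter [simp]: "inv_letter (inv_letter x) = x"
  by (cases x) auto

lemma inv_letter_neq [simp]: "inv_letter x \<noteq> x" "x \<noteq> inv_letter x"
  by (cases x; simp)+

lemma reduced_Nil [simp]: "reduced []"
  by (simp add: reduced_def)

lemma reduced_Cons: "reduced (x # w) \<longleftrightarrow> reduced w \<and> (w \<noteq> [] \<longrightarrow> hd w \<noteq> inv_letter x)"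
  by (auto simp: reduced_def successively_Cons)

lemma reduced_cancel_Cons: "reduced w \<Longrightarrow> reduced (cancel_Cons x w)"
  by (cases w) (auto simp: reduced_Cons)

lemma cancel_Cons_reduced: "reduced (x # w) \<Longrightarrow> cancel_Cons x w = x # w"
  by (cases w) (auto simp: reduced_Cons)

lemma cancel_Cons_inverse: "reduced w \<Longrightarrow> cancel_Cons x (cancel_Cons (inv_letter x) w) = w"
  by (cases w) (auto simp: cancel_Cons_reduced)

lemma reduced_foldr_cancel_Cons: "reduced v \<Longrightarrow> reduced (foldr cancel_Cons u v)"
  by (induction u) (auto simp: reduced_cancel_Cons)

lemma reduced_reduce: "reduced (reduce w)"
  by (simp add: reduce_def reduced_foldr_cancel_Cons)

lemma reduce_reduced: "reduced w \<Longrightarrow> reduce w = w"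
  by (induction w) (auto simp: reduce_def cancel_Cons_reduced reduced_Cons)

lemma reduce_append: "reduce (u @ v) = foldr cancel_Cons u (reduce v)"
  by (simp add: reduce_def)

lemma foldr_cancel_Cons_reduce:
  assumes "reduced v"
  shows "foldr cancel_Cons (reduce u) v = foldr cancel_Cons u v"
proof (induction u)
  case Nil
  then show ?case by (simp add: reduce_def)
next
  case (Cons x u)
  have "foldr cancel_Cons (cancel_Cons x w) v = cancel_Cons x (foldr cancel_Cons w v)" for w
    using assms
    by (cases w) (auto simp: cancel_Cons_inverse reduced_foldr_cancel_Cons)
  from this[of "reduce u"] Cons show ?case
    by (simp add: reduce_def)
qed

lemma reduce_append_reduce_left: "reduce (reduce u @ v) = reduce (u @ v)"
  by (simp add: reduce_append foldr_cancel_Cons_reduce reduced_reduce)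

lemma reduce_append_reduce_right: "reduce (u @ reduce v) = reduce (u @ v)"
  by (simp add: reduce_append reduce_reduced reduced_reduce)

lemma reduce_in_lists: "w \<in> lists L \<Longrightarrow> reduce w \<in> lists L"
proof (induction w)
  case Nil
  then show ?case by (simp add: reduce_def)
next
  case (Cons x w)
  then have "reduce w \<in> lists L" "x \<in> L" by auto
  then show ?case
    by (cases "reduce w") (auto simp: reduce_def)
qed

lemma reduce_inverse_word: "reduce (rev (map inv_letter w) @ w) = []"
proof (induction w)
  case Nil
  then show ?case by (simp add: reduce_def)
next
  case (Cons x w)
  have "cancel_Cons (inv_letter x) (cancel_Cons x (reduce w)) = reduce w"
    using cancel_Cons_inverse[of "reduce w" "inv_letter x"] by (simp add: reduced_reduce)
  with Cons show ?case
    by (simp add: reduce_def)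
qed

lemma inverse_word_in_lists:
  "w \<in> lists (Gen ` S \<union> Inv ` S) \<Longrightarrow> rev (map inv_letter w) \<in> lists (Gen ` S \<union> Inv ` S)"
  by (induction w) auto

lemma group_free_group: "group (free_group S)"
proof (rule groupI)
  fix w assume w: "w \<in> carrier (free_group S)"
  let ?v = "reduce (rev (map inv_letter w))"
  have "rev (map inv_letter w) \<in> lists (Gen ` S \<union> Inv ` S)"
    by (rule inverse_word_in_lists) (use w in \<open>simp add: free_group_def\<close>)
  from reduce_in_lists[OF this] have "?v \<in> carrier (free_group S)"
    by (simp add: free_group_def reduced_reduce)
  moreover have "?v \<otimes>\<^bsub>free_group S\<^esub> w = \<one>\<^bsub>free_group S\<^esub>"
    by (simp add: free_group_def reduce_append_reduce_left reduce_inverse_word)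
  ultimately show "\<exists>v\<in>carrier (free_group S). v \<otimes>\<^bsub>free_group S\<^esub> w = \<one>\<^bsub>free_group S\<^esub>"
    by blast
next
  fix u v assume "u \<in> carrier (free_group S)" "v \<in> carrier (free_group S)"
  then have "u @ v \<in> lists (Gen ` S \<union> Inv ` S)"
    by (auto simp: free_group_def)
  from reduce_in_lists[OF this] show "u \<otimes>\<^bsub>free_group S\<^esub> v \<in> carrier (free_group S)"
    by (simp add: free_group_def reduced_reduce)
qed (auto simp: free_group_def reduce_append_reduce_left reduce_append_reduce_right reduce_reduced)


section \<open>One-relator groups\<close>

definition normal_closure :: "('a, 'm) monoid_scheme \<Rightarrow> 'a set \<Rightarrow> 'a set" where
  "normal_closure G R = \<Inter>{N. N \<lhd> G \<and> R \<subseteq> N}"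

definition one_relator_group :: "'a set \<Rightarrow> 'a letter list \<Rightarrow> 'a letter list set monoid" where
  "one_relator_group S r = free_group S Mod normal_closure (free_group S) {r}"


section \<open>Stable commutator length\<close>

abbreviation commutator_subgroup :: "('a, 'm) monoid_scheme \<Rightarrow> 'a set" where
  "commutator_subgroup G \<equiv> derived G (carrier G)"

text \<open>
  The set \<open>derived_set G (carrier G)\<close> consists of the commutators of \<open>G\<close>. Both lengths are
  meaningful only for \<open>g \<in> commutator_subgroup G\<close>.
\<close>

definition commutator_length :: "('a, 'm) monoid_scheme \<Rightarrow> 'a \<Rightarrow> nat" where
  "commutator_length G g =
     (LEAST n. \<exists>cs. length cs = n \<and> set cs \<subseteq> derived_set G (carrier G) \<and>
                    g = foldr (\<otimes>\<^bsub>G\<^esub>) cs \<one>\<^bsub>G\<^esub>)"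

definition scl :: "('a, 'm) monoid_scheme \<Rightarrow> 'a \<Rightarrow> real" where
  "scl G g = lim (\<lambda>n. real (commutator_length G (g [^]\<^bsub>G\<^esub> n)) / real n)"

end

(*
  Write A, B for the inverses of a, b and put c = [a, b], p = [B, A]. Up to conjugation by a,
  r = c c p c p and r' = c c c p p. With e = c p the first relation says c = e^-2 and p = e^3,
  the second one c^3 = p^-2; since p = (ba)^-1 c^-1 (ba), both groups are HNN extensions, with
  stable letter a, of the Baumslag-Solitar group BS(2, 3) generated by e (respectively c) and ba,
  and replacing a by p a (respectively c^3 a) while fixing ba exchanges the two presentations.

  Both lower bounds on scl come from one quasimorphism: f = #Ab + #bA - #aB - #Ba, where # counts
  subwords of reduced words, is odd and has defect 1, so f(g) <= 4 cl(g), while f(r^n) = 4n and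
  f(r'^n) = 2n. For the upper bounds, r' is a commutator, hence cl(r'^n) <= n/2 + 1, and r times a
  conjugate of r is a product of two commutators. As (xy)^n equals x^n y^n up to n/2
  commutators, this gives cl(r^n) <= n + O(1).
*)

theory Submission
  imports Defs
begin

section \<open>Products of commutators\<close>

context group
begin

text \<open>Together with \<open>word_simps\<close>, these cancellations on right-nested products
  let the simplifier verify identities of words that hold in every group.\<close>

lemma inv_mult_cancel [simp]:
  "x \<in> carrier G \<Longrightarrow> y \<in> carrier G \<Longrightarrow> inv x \<otimes> (x \<otimes> y) = y"
  "x \<in> carrier G \<Longrightarrow> y \<in> carrier G \<Longrightarrow> x \<otimes> (inv x \<otimes> y) = y"
  by (simp_all flip: m_assoc)

lemmas word_simps = m_assoc inv_mult_group

definition commutator :: "'a \<Rightarrow> 'a \<Rightarrow> 'a" where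
  "commutator x y = x \<otimes> y \<otimes> inv x \<otimes> inv y"

lemma commutator_closed [simp]:
  "x \<in> carrier G \<Longrightarrow> y \<in> carrier G \<Longrightarrow> commutator x y \<in> carrier G"
  by (simp add: commutator_def)

lemma derived_set_iff:
  "g \<in> derived_set G (carrier G) \<longleftrightarrow>
     (\<exists>x\<in>carrier G. \<exists>y\<in>carrier G. g = commutator x y)"
  by (auto simp: commutator_def)

text \<open>Trivial commutators may serve as padding, so exactly \<open>n\<close> factors amounts to
  at most \<open>n\<close>. Upper bounds for commutator length thereby become membership statements
  that combine under products, conjugation and inversion.\<close>

definition commutator_products :: "nat \<Rightarrow> 'a set" where
  "commutator_products n =
     {foldr (\<otimes>) cs \<one> |cs. length cs = n \<and> set cs \<subseteq> derived_set G (carrier G)}"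

lemma commutator_products_0 [simp]: "commutator_products 0 = {\<one>}"
  by (auto simp: commutator_products_def)

lemma derived_set_closed: "derived_set G (carrier G) \<subseteq> carrier G"
  by auto

lemma commutator_products_Suc:
  "commutator_products (Suc n) =
     {c \<otimes> g |c g. c \<in> derived_set G (carrier G) \<and> g \<in> commutator_products n}"
  (is "?L = ?R")
proof
  show "?L \<subseteq> ?R"
  proof
    fix h assume "h \<in> ?L"
    then obtain cs where cs: "h = foldr (\<otimes>) cs \<one>" "length cs = Suc n"
      "set cs \<subseteq> derived_set G (carrier G)"
      unfolding commutator_products_def by blast
    from cs(2) obtain c ds where "cs = c # ds" "length ds = n"
      by (cases cs) auto
    with cs show "h \<in> ?R"
      unfolding commutator_products_def by (intro CollectI exI[of _ c] exI) auto
  qed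
  show "?R \<subseteq> ?L"
  proof
    fix h assume "h \<in> ?R"
    then obtain c ds where cs: "h = c \<otimes> foldr (\<otimes>) ds \<one>" "length ds = n"
      "set ds \<subseteq> derived_set G (carrier G)" "c \<in> derived_set G (carrier G)"
      unfolding commutator_products_def by blast
    then show "h \<in> ?L"
      unfolding commutator_products_def by (intro CollectI exI[of _ "c # ds"]) auto
  qed
qed

lemma commutator_products_closed: "g \<in> commutator_products n \<Longrightarrow> g \<in> carrier G"
proof (induction n arbitrary: g)
  case (Suc n)
  then obtain u v h where "g = commutator u v \<otimes> h" "u \<in> carrier G" "v \<in> carrier G"
      "h \<in> commutator_products n"
    unfolding commutator_products_Suc derived_set_iff by blast
  with Suc.IH[of h] show ?case by simp
qed simp

lemma commutator_in_commutator_products: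
  "x \<in> carrier G \<Longrightarrow> y \<in> carrier G \<Longrightarrow> commutator x y \<in> commutator_products 1"
proof -
  assume "x \<in> carrier G" "y \<in> carrier G"
  then have "commutator x y = commutator x y \<otimes> \<one>" "commutator x y \<in> derived_set G (carrier G)"
    unfolding derived_set_iff by auto
  then show "commutator x y \<in> commutator_products 1"
    unfolding One_nat_def commutator_products_Suc commutator_products_0 by blast
qed

lemma mult_commutator_products:
  assumes "g \<in> commutator_products m" "h \<in> commutator_products n"
  shows "g \<otimes> h \<in> commutator_products (m + n)"
  using assms(1)
proof (induction m arbitrary: g)
  case 0
  with assms(2) show ?case
    by (simp add: commutator_products_closed)
next
  case (Suc m)
  then obtain c k where k: "g = c \<otimes> k" "c \<in> derived_set G (carrier G)" "k \<in> commutator_products m"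
    unfolding commutator_products_Suc by blast
  have "g \<otimes> h = c \<otimes> (k \<otimes> h)"
    using subsetD[OF derived_set_closed k(2)] k(1) commutator_products_closed[OF k(3)]
      commutator_products_closed[OF assms(2)] by (simp add: m_assoc)
  with k Suc.IH[OF k(3)] show ?case
    unfolding add_Suc commutator_products_Suc by blast
qed

lemma commutator_products_mono:
  assumes "m \<le> n"
  shows "commutator_products m \<subseteq> commutator_products n"
  using assms
proof (induction n rule: dec_induct)
  case (step n)
  have "g \<in> commutator_products (Suc n)" if "g \<in> commutator_products n" for g
    using mult_commutator_products[OF commutator_in_commutator_products[of \<one> \<one>] that] that
    by (simp add: commutator_def commutator_products_closed)
  with step show ?case by blast
qed simp

lemma conj_commutator_products:
  assumes "g \<in> commutator_products n" "x \<in> carrier G"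
  shows "x \<otimes> g \<otimes> inv x \<in> commutator_products n"
  using assms(1)
proof (induction n arbitrary: g)
  case 0
  with assms(2) show ?case by simp
next
  case (Suc n)
  then obtain u v h where h: "g = commutator u v \<otimes> h" "u \<in> carrier G" "v \<in> carrier G"
      "h \<in> commutator_products n"
    unfolding commutator_products_Suc derived_set_iff by blast
  have "x \<otimes> g \<otimes> inv x =
      commutator (x \<otimes> u \<otimes> inv x) (x \<otimes> v \<otimes> inv x) \<otimes> (x \<otimes> h \<otimes> inv x)"
    using h assms(2) commutator_products_closed[OF h(4)]
    by (simp add: commutator_def word_simps)
  moreover have "commutator (x \<otimes> u \<otimes> inv x) (x \<otimes> v \<otimes> inv x) \<in> commutator_products 1"
    using h assms(2) by (intro commutator_in_commutator_products) auto
  ultimately show ?case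
    using mult_commutator_products[OF _ Suc.IH[OF h(4)]] by fastforce
qed

lemma inv_commutator_products:
  assumes "g \<in> commutator_products n"
  shows "inv g \<in> commutator_products n"
  using assms
proof (induction n arbitrary: g)
  case 0
  then show ?case by simp
next
  case (Suc n)
  then obtain u v h where h: "g = commutator u v \<otimes> h" "u \<in> carrier G" "v \<in> carrier G"
      "h \<in> commutator_products n"
    unfolding commutator_products_Suc derived_set_iff by blast
  have "inv g = inv h \<otimes> commutator v u"
    using h commutator_products_closed[OF h(4)]
    by (simp add: commutator_def word_simps)
  then show ?case
    using mult_commutator_products[OF Suc.IH[OF h(4)] commutator_in_commutator_products[OF h(3,2)]]
    by simp
qed

lemma commutator_products_subset_commutator_subgroup:
  "commutator_products n \<subseteq> commutator_subgroup G"
proof (induction n)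
  case 0
  then show ?case
    by (simp add: derived_def generate.one)
next
  case (Suc n)
  then show ?case
    unfolding commutator_products_Suc derived_def by (blast intro: generate.incl generate.eng)
qed

lemma commutator_length_le:
  "g \<in> commutator_products n \<Longrightarrow> commutator_length G g \<le> n"
  unfolding commutator_length_def commutator_products_def by (blast intro: Least_le)

text \<open>The \<open>LEAST\<close> in \<open>commutator_length\<close> is meaningful once some
  representation exists; the hypothesis supplies one, with any number of factors.\<close>

lemma in_commutator_products_commutator_length:
  assumes "g \<in> commutator_products n"
  shows "g \<in> commutator_products (commutator_length G g)"
proof -
  have "\<exists>cs. length cs = n \<and> set cs \<subseteq> derived_set G (carrier G) \<and> g = foldr (\<otimes>) cs \<one>"
    using assms unfolding commutator_products_def by blast
  from LeastI[of "\<lambda>n. \<exists>cs. length cs = n \<and> set cs \<subseteq> derived_set G (carrier G) \<and>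
      g = foldr (\<otimes>) cs \<one>", OF this] show ?thesis
    unfolding commutator_products_def commutator_length_def by blast
qed

section \<open>Powers of products and of commutators\<close>

lemma pow_conj:
  "x \<in> carrier G \<Longrightarrow> y \<in> carrier G \<Longrightarrow>
     (x \<otimes> y \<otimes> inv x) [^] (n::nat) = x \<otimes> y [^] n \<otimes> inv x"
  by (induction n) (simp_all add: word_simps)

text \<open>Sorting the letters \<open>x\<close> to the left and \<open>y\<close> to the right costs
  one commutator per two factors \<open>x y\<close>, not one per factor. This saving makes both
  upper bounds on scl sharp. The induction accordingly descends by two.\<close>

lemma pow_mult_commutator_products:
  assumes "x \<in> carrier G" "y \<in> carrier G"
  shows "\<exists>t\<in>commutator_products (n div 2). (x \<otimes> y) [^] n = x [^] n \<otimes> t \<otimes> y [^] n"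
proof (induction n rule: nat_less_induct)
  case (1 n)
  consider "n = 0" | "n = 1" | m where "n = m + 2"
    by (metis One_nat_def add_2_eq_Suc' not0_implies_Suc)
  then show ?case
  proof cases
    case 3
    obtain t where t: "t \<in> commutator_products (m div 2)"
      "(x \<otimes> y) [^] m = x [^] m \<otimes> t \<otimes> y [^] m"
      using 1[rule_format, of m] 3 by auto
    define q where "q = y [^] m"
    \<comment> \<open>\<open>c\<close> is forced by \<open>q x y x = x^2 c y q\<close>, that is
      \<open>c = x^-2 q (x y x) q^-1 y^-1\<close>, and conjugating by \<open>x\<close> exhibits it
      as a single commutator. \<open>u\<close> consists of \<open>t\<close>, moved past
      \<open>x^2\<close>, followed by \<open>c\<close>.\<close>
    define c where "c = inv x \<otimes> commutator (inv x \<otimes> q) (x \<otimes> y \<otimes> x) \<otimes> x"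
    define u where "u = inv x \<otimes> inv x \<otimes> t \<otimes> x \<otimes> x \<otimes> c"
    have G: "t \<in> carrier G" "q \<in> carrier G" "x [^] m \<in> carrier G"
      using assms t by (auto simp: commutator_products_closed q_def)
    have qy: "y \<otimes> q = q \<otimes> y"
      using assms by (metis q_def nat_pow_Suc nat_pow_Suc2)
    have "c \<in> commutator_products 1"
      using conj_commutator_products[OF commutator_in_commutator_products, of "inv x \<otimes> q"
        "x \<otimes> y \<otimes> x" "inv x"] assms G by (simp add: c_def)
    moreover have "inv x \<otimes> inv x \<otimes> t \<otimes> x \<otimes> x \<in> commutator_products (m div 2)"
      using conj_commutator_products[OF t(1), of "inv x \<otimes> inv x"] assms G
      by (simp add: word_simps)
    ultimately have u: "u \<in> commutator_products (n div 2)"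
      using mult_commutator_products 3 by (fastforce simp: u_def)
    have "(x \<otimes> y) [^] n = x [^] m \<otimes> t \<otimes> q \<otimes> (x \<otimes> y) \<otimes> (x \<otimes> y)"
      using 3 t assms by (simp add: q_def nat_pow_Suc)
    also have "\<dots> = x [^] m \<otimes> x \<otimes> x \<otimes> u \<otimes> (y \<otimes> q \<otimes> y)"
      using assms G by (simp add: u_def c_def commutator_def word_simps)
    also have "\<dots> = x [^] n \<otimes> u \<otimes> y [^] n"
      using 3 by (simp add: qy) (simp add: q_def)
    finally show ?thesis using u by blast
  qed (use assms in auto)
qed

text \<open>A commutator is \<open>x\<close> times a conjugate of \<open>x^-1\<close>. Its power is
  therefore \<open>x^n\<close> times \<open>y x^-n y^-1\<close> up to \<open>n div 2\<close>
  commutators, and these two outer factors form one further commutator, that of \<open>x^n\<close>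
  and \<open>y\<close>.\<close>

lemma pow_commutator_commutator_products:
  assumes "x \<in> carrier G" "y \<in> carrier G"
  shows "commutator x y [^] n \<in> commutator_products (n div 2 + 1)"
proof -
  define z where "z = y \<otimes> inv x \<otimes> inv y"
  obtain t where t: "t \<in> commutator_products (n div 2)"
      "(x \<otimes> z) [^] n = x [^] n \<otimes> t \<otimes> z [^] n"
    using pow_mult_commutator_products[of x z n] assms by (auto simp: z_def)
  have "commutator x y [^] n = x [^] n \<otimes> t \<otimes> (y \<otimes> inv (x [^] n) \<otimes> inv y)"
    using t(2) pow_conj[of y "inv x" n] assms
    by (simp only: z_def commutator_def nat_pow_inv m_assoc m_closed inv_closed nat_pow_closed)
  also have "\<dots> = (x [^] n \<otimes> t \<otimes> inv (x [^] n)) \<otimes> commutator (x [^] n) y"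
    using assms commutator_products_closed[OF t(1)] by (simp add: commutator_def word_simps)
  finally show ?thesis
    using mult_commutator_products[OF conj_commutator_products[OF t(1)]
        commutator_in_commutator_products[of "x [^] n" y]] assms
    by simp
qed

text \<open>
  The hypothesis says that two parallel copies of \<open>g\<close> bound a surface of genus two, which yields
  \<open>scl g \<le> 1\<close>.
\<close>

lemma pow_commutator_products_of_conj_eq:
  assumes "g \<in> carrier G" "h \<in> carrier G"
      "x \<in> carrier G" "y \<in> carrier G" "u \<in> carrier G" "v \<in> carrier G"
    and eq: "g \<otimes> (h \<otimes> g \<otimes> inv h) = commutator x y \<otimes> commutator u v"
    and "g \<in> commutator_products k"
  shows "g [^] n \<in> commutator_products (n + 3 + k)"
proof -
  \<comment> \<open>Both sides of \<open>eq\<close> are raised to the power \<open>m\<close>. The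
    left side is \<open>g^m\<close> times a conjugate of \<open>g^m\<close> with \<open>s\<close> in
    between; the right side is a product of \<open>3 * (m div 2) + 2\<close> commutators.\<close>
  have even: "g [^] (2 * m) \<in> commutator_products (2 * m + 3)" for m :: nat
  proof -
    define g' where "g' = h \<otimes> g \<otimes> inv h"
    obtain s where s: "s \<in> commutator_products (m div 2)"
      "(g \<otimes> g') [^] m = g [^] m \<otimes> s \<otimes> g' [^] m"
      using pow_mult_commutator_products[of g g' m] assms by (auto simp: g'_def)
    obtain t where t: "t \<in> commutator_products (m div 2)"
      "(commutator x y \<otimes> commutator u v) [^] m =
         commutator x y [^] m \<otimes> t \<otimes> commutator u v [^] m"
      using pow_mult_commutator_products[of "commutator x y" "commutator u v" m] assms by auto
    have G: "s \<in> carrier G" "g [^] m \<in> carrier G"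
      using s assms by (auto simp: commutator_products_closed)
    have "commutator x y [^] m \<otimes> t \<otimes> commutator u v [^] m
        \<in> commutator_products ((m div 2 + 1) + m div 2 + (m div 2 + 1))"
      using assms t by (intro mult_commutator_products pow_commutator_commutator_products)
    then have *: "g [^] m \<otimes> s \<otimes> (h \<otimes> g [^] m \<otimes> inv h) \<in> commutator_products (3 * (m div 2) + 2)"
      using eq s(2) t(2) pow_conj[of h g m] assms
      by (simp only: g'_def ac_simps flip: mult_2) (simp add: numeral_3_eq_3 algebra_simps)
    \<comment> \<open>A conjugate of \<open>s^-1\<close> removes \<open>s\<close>, and the
      commutator of \<open>h\<close> with \<open>g^-m\<close> undoes the conjugation by
      \<open>h\<close>. The total is \<open>4 * (m div 2) + 3\<close>, at most
      \<open>2 * m + 3\<close>.\<close>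
    have "g [^] (2 * m) = g [^] m \<otimes> g [^] m"
      using assms by (simp add: nat_pow_mult mult_2)
    also have "\<dots> = (g [^] m \<otimes> inv s \<otimes> inv (g [^] m)) \<otimes>
        (g [^] m \<otimes> s \<otimes> (h \<otimes> g [^] m \<otimes> inv h)) \<otimes> commutator h (inv (g [^] m))"
      using assms G by (simp add: commutator_def word_simps)
    also have "\<dots> \<in> commutator_products (m div 2 + (3 * (m div 2) + 2) + 1)"
      using assms G s *
      by (intro mult_commutator_products[OF mult_commutator_products[OF _ *]]
          conj_commutator_products inv_commutator_products commutator_in_commutator_products) auto
    finally show ?thesis
      using commutator_products_mono[of "m div 2 + (3 * (m div 2) + 2) + 1" "2 * m + 3"] by auto
  qed
  show ?thesis
  proof (cases "even n")
    case True
    then obtain m where "n = 2 * m" by blast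
    with even[of m] commutator_products_mono[of "2 * m + 3" "n + 3 + k"] show ?thesis by auto
  next
    case False
    then obtain m where n: "n = 2 * m + 1" by (rule oddE)
    \<comment> \<open>An odd power leaves one spare factor \<open>g\<close>, paid for once by the
      crude bound \<open>k\<close>.\<close>
    have "g [^] n \<in> commutator_products (2 * m + 3 + k)"
      using mult_commutator_products[OF even[of m] assms(8)] by (simp add: n)
    with commutator_products_mono[of "2 * m + 3 + k" "n + 3 + k"] n show ?thesis by auto
  qed
qed

section \<open>Lower bounds from odd quasimorphisms, and a criterion for the value of scl\<close>

lemma quasimorphism_commutator_products:
  fixes f :: "'a \<Rightarrow> int"
  assumes quasi: "\<And>x y. x \<in> carrier G \<Longrightarrow> y \<in> carrier G \<Longrightarrow> \<bar>f (x \<otimes> y) - f x - f y\<bar> \<le> d"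
    and odd: "\<And>x. x \<in> carrier G \<Longrightarrow> f (inv x) = - f x"
    and "g \<in> commutator_products n"
  shows "f g \<le> 4 * d * int n"
  using assms(3)
proof (induction n arbitrary: g)
  case 0
  \<comment> \<open>Oddness forces \<open>f \<one> = 0\<close>.\<close>
  with odd[of \<one>] show ?case by simp
next
  case (Suc n)
  then obtain x y h where h: "g = commutator x y \<otimes> h" "x \<in> carrier G" "y \<in> carrier G"
      "h \<in> commutator_products n"
    unfolding commutator_products_Suc derived_set_iff by blast
  have "f g \<le> f (commutator x y) + f h + d"
    using quasi[of "commutator x y" h] h commutator_products_closed[OF h(4)] by simp
  \<comment> \<open>By oddness the values of \<open>f\<close> on the four letters cancel, which
    leaves one defect for each of three products; multiplication by \<open>h\<close> costs the
    fourth.\<close>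
  moreover have "f (commutator x y) \<le> 3 * d"
    using quasi[of "x \<otimes> y \<otimes> inv x" "inv y"] quasi[of "x \<otimes> y" "inv x"] quasi[of x y]
      odd[of x] odd[of y] h by (simp add: commutator_def)
  ultimately show ?case
    using Suc.IH[OF h(4)] by (simp add: algebra_simps)
qed

text \<open>The lower and upper estimates have the same slope \<sigma>, and their bounded errors
  vanish after division by \<open>n\<close>. The sandwich also gives convergence, so that
  \<open>lim\<close> really denotes the limit.\<close>

lemma scl_eqI:
  fixes f :: "'a \<Rightarrow> int" and \<sigma> A B :: real
  assumes quasi: "\<And>x y. x \<in> carrier G \<Longrightarrow> y \<in> carrier G \<Longrightarrow> \<bar>f (x \<otimes> y) - f x - f y\<bar> \<le> d"
    and odd: "\<And>x. x \<in> carrier G \<Longrightarrow> f (inv x) = - f x"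
    and "d > 0"
    and lower: "\<And>n. f (g [^] n) \<ge> 4 * d * \<sigma> * real n - A"
    and upper: "\<And>n. g [^] n \<in> commutator_products (N n)" "\<And>n. real (N n) \<le> \<sigma> * real n + B"
  shows "scl G g = \<sigma>"
  unfolding scl_def
proof (rule limI, rule tendsto_sandwich)
  define l where "l n = real (commutator_length G (g [^] n))" for n :: nat
  have "(\<lambda>n. \<sigma> - A / (4 * d) * (1 / real n)) \<longlonglongrightarrow> \<sigma> - A / (4 * d) * 0"
    by (intro tendsto_intros lim_1_over_n)
  then show "(\<lambda>n. \<sigma> - A / (4 * d) * (1 / real n)) \<longlonglongrightarrow> \<sigma>" by simp
  have "(\<lambda>n. \<sigma> + B * (1 / real n)) \<longlonglongrightarrow> \<sigma> + B * 0"
    by (intro tendsto_intros lim_1_over_n)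
  then show "(\<lambda>n. \<sigma> + B * (1 / real n)) \<longlonglongrightarrow> \<sigma>" by simp
  show "\<forall>\<^sub>F n in sequentially. \<sigma> - A / (4 * d) * (1 / real n) \<le> l n / real n"
    using eventually_gt_at_top[of 0]
  proof eventually_elim
    case (elim n)
    have "f (g [^] n) \<le> 4 * d * int (commutator_length G (g [^] n))"
      by (rule quasimorphism_commutator_products[OF quasi odd
          in_commutator_products_commutator_length[OF upper(1)]])
    then have "of_int (f (g [^] n)) \<le> 4 * d * l n"
      unfolding l_def by (metis of_int_le_iff of_int_mult of_int_numeral of_int_of_nat_eq)
    with lower[of n] have "4 * d * \<sigma> * real n - A \<le> 4 * d * l n" by linarith
    with \<open>d > 0\<close> have "\<sigma> * real n - A / (4 * d) \<le> l n" by (simp add: field_simps)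
    with elim show ?case by (simp add: field_simps)
  qed
  show "\<forall>\<^sub>F n in sequentially. l n / real n \<le> \<sigma> + B * (1 / real n)"
    using eventually_gt_at_top[of 0]
  proof eventually_elim
    case (elim n)
    have "l n \<le> \<sigma> * real n + B"
      using commutator_length_le[OF upper(1)] upper(2)[of n] unfolding l_def
      by (meson of_nat_le_iff order_trans)
    with elim show ?case by (simp add: field_simps)
  qed
qed

end

section \<open>Homomorphisms on free groups\<close>

lemma carrier_free_group:
  "w \<in> carrier (free_group S) \<longleftrightarrow> w \<in> lists (Gen ` S \<union> Inv ` S) \<and> reduced w"
  by (simp add: free_group_def)

lemma mult_free_group: "u \<otimes>\<^bsub>free_group S\<^esub> v = reduce (u @ v)"
  by (simp add: free_group_def)

lemma one_free_group: "\<one>\<^bsub>free_group S\<^esub> = []"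
  by (simp add: free_group_def)

lemma Gen_in_free_group [simp]: "[Gen x] \<in> carrier (free_group S) \<longleftrightarrow> x \<in> S"
  by (auto simp: carrier_free_group reduced_Cons)

definition inverse_word :: "'a letter list \<Rightarrow> 'a letter list" where
  "inverse_word w = rev (map inv_letter w)"

lemma inverse_word_eq_Nil [simp]: "inverse_word w = [] \<longleftrightarrow> w = []"
  by (simp add: inverse_word_def)

lemma last_inverse_word [simp]: "w \<noteq> [] \<Longrightarrow> last (inverse_word w) = inv_letter (hd w)"
  by (simp add: inverse_word_def last_rev hd_map)

text \<open>Reversing and inverting letters creates no cancelling pair, so the formal inverse of a
  reduced word is already the group inverse.\<close>

lemma reduced_inverse_word:
  assumes "reduced w"
  shows "reduced (inverse_word w)"
proof -
  have *: "(\<lambda>x y :: 'a letter. y \<noteq> inv_letter x) = (\<lambda>x y. inv_letter x \<noteq> y)"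
    by auto
  show ?thesis
    using assms[unfolded reduced_def *]
    by (simp add: reduced_def inverse_word_def successively_rev successively_map)
qed

lemma inverse_word_closed:
  "w \<in> carrier (free_group S) \<Longrightarrow> inverse_word w \<in> carrier (free_group S)"
  unfolding carrier_free_group
  using inverse_word_in_lists[of w S] reduced_inverse_word[of w] by (simp add: inverse_word_def)

lemma inv_free_group:
  assumes "w \<in> carrier (free_group S)"
  shows "inv\<^bsub>free_group S\<^esub> w = inverse_word w"
proof -
  have "inverse_word w \<otimes>\<^bsub>free_group S\<^esub> w = \<one>\<^bsub>free_group S\<^esub>"
    by (simp add: mult_free_group one_free_group reduce_inverse_word inverse_word_def)
  then show ?thesis
    using group.inv_equality[OF group_free_group _ assms inverse_word_closed[OF assms]] by simp
qed

section \<open>The universal property of free groups\<close>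

context group
begin

text \<open>Evaluation is defined on unreduced words too; its invariance under \<open>reduce\<close>
  then makes it the homomorphism extending \<open>f\<close>.\<close>

fun word_eval :: "('c \<Rightarrow> 'a) \<Rightarrow> 'c letter list \<Rightarrow> 'a" where
  "word_eval f [] = \<one>"
| "word_eval f (Gen x # w) = f x \<otimes> word_eval f w"
| "word_eval f (Inv x # w) = inv f x \<otimes> word_eval f w"

lemma word_eval_closed:
  assumes "f \<in> S \<rightarrow> carrier G" "w \<in> lists (Gen ` S \<union> Inv ` S)"
  shows "word_eval f w \<in> carrier G"
  using assms(2)
proof (induction w)
  case (Cons x w)
  then show ?case
    using assms(1) by (cases x) auto
qed simp

lemma word_eval_append:
  assumes "f \<in> S \<rightarrow> carrier G" "u \<in> lists (Gen ` S \<union> Inv ` S)" "v \<in> lists (Gen ` S \<union> Inv ` S)"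
  shows "word_eval f (u @ v) = word_eval f u \<otimes> word_eval f v"
  using assms(2)
proof (induction u)
  case Nil
  with word_eval_closed[OF assms(1,3)] show ?case by simp
next
  case (Cons x u)
  then have "word_eval f u \<in> carrier G"
    using word_eval_closed[OF assms(1), of u] by auto
  with Cons word_eval_closed[OF assms(1,3)] assms(1) show ?case
    by (cases x) (auto simp: Pi_iff m_assoc)
qed

lemma word_eval_cancel_Cons:
  assumes "f \<in> S \<rightarrow> carrier G" "x # w \<in> lists (Gen ` S \<union> Inv ` S)"
  shows "word_eval f (cancel_Cons x w) = word_eval f (x # w)"
proof (cases w)
  case (Cons y v)
  then have "word_eval f v \<in> carrier G"
    using assms word_eval_closed[OF assms(1), of v] by auto
  with Cons assms show ?thesis
    by (cases x) (auto simp: Pi_iff)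
qed simp

lemma word_eval_reduce:
  assumes "f \<in> S \<rightarrow> carrier G" "w \<in> lists (Gen ` S \<union> Inv ` S)"
  shows "word_eval f (reduce w) = word_eval f w"
  using assms(2)
proof (induction w)
  case (Cons x w)
  have "word_eval f (reduce (x # w)) = word_eval f (x # reduce w)"
    using word_eval_cancel_Cons[OF assms(1), of x "reduce w"] reduce_in_lists[of w] Cons
    by (auto simp: reduce_def)
  also have "\<dots> = word_eval f (x # w)"
    using Cons by (cases x) auto
  finally show ?case .
qed (simp add: reduce_def)

lemma word_eval_hom:
  assumes "f \<in> S \<rightarrow> carrier G"
  shows "word_eval f \<in> hom (free_group S) G"
proof (rule homI)
  fix u v assume "u \<in> carrier (free_group S)" "v \<in> carrier (free_group S)"
  then show "word_eval f (u \<otimes>\<^bsub>free_group S\<^esub> v) = word_eval f u \<otimes> word_eval f v"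
    using word_eval_reduce[OF assms, of "u @ v"] word_eval_append[OF assms, of u v]
    by (simp add: carrier_free_group mult_free_group)
qed (use assms in \<open>simp add: carrier_free_group word_eval_closed\<close>)

lemma hom_word_eval:
  assumes "group H" "h \<in> hom G H" "f \<in> S \<rightarrow> carrier G" "w \<in> lists (Gen ` S \<union> Inv ` S)"
  shows "h (word_eval f w) = group.word_eval H (\<lambda>x. h (f x)) w"
proof -
  interpret H: group H by fact
  interpret h: group_hom G H h
    using assms(2) by unfold_locales
  show ?thesis
    using assms(4)
  proof (induction w)
    case (Cons x w)
    then have "word_eval f w \<in> carrier G"
      using word_eval_closed[OF assms(3), of w] by auto
    with Cons assms(3) show ?case
      by (cases x) (auto simp: Pi_iff)
  qed simp
qed

text \<open>The uniqueness half of the universal property: two homomorphisms can be compared on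
  generators alone.\<close>

lemma hom_free_group_eq_word_eval:
  assumes "h \<in> hom (free_group S) G" "w \<in> carrier (free_group S)"
  shows "h w = word_eval (\<lambda>x. h [Gen x]) w"
proof -
  interpret F: group "free_group S" by (rule group_free_group)
  interpret h: group_hom "free_group S" G h
    using assms(1) by unfold_locales
  show ?thesis
    using assms(2)
  proof (induction w)
    case Nil
    then show ?case using h.hom_one by (simp add: one_free_group)
  next
    case (Cons x w)
    then have w: "w \<in> carrier (free_group S)" "reduced (x # w)"
      by (auto simp: carrier_free_group reduced_Cons)
    have x: "[x] \<in> carrier (free_group S)"
      using Cons.prems by (auto simp: carrier_free_group reduced_Cons)
    have "h (x # w) = h [x] \<otimes> h w"
      using h.hom_mult[OF x w(1)] w by (simp add: mult_free_group reduce_reduced)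
    moreover have "h [Inv y] = inv h [Gen y]" if "x = Inv y" for y
    proof -
      have "[Gen y] \<in> carrier (free_group S)"
        using x that by (auto simp: carrier_free_group reduced_Cons)
      from h.hom_inv[OF this] inv_free_group[OF this] show ?thesis
        by (simp add: inverse_word_def)
    qed
    ultimately show ?case
      using Cons.IH[OF w(1)] by (cases x) auto
  qed
qed

end

section \<open>Normal closures and isomorphisms of one-relator quotients\<close>

lemma normal_closure_normal:
  assumes "group G" "R \<subseteq> carrier G"
  shows "normal_closure G R \<lhd> G"
proof -
  interpret group G by fact
  have "carrier G \<lhd> G" by (rule normal_self)
  with assms(2) have ne: "{N. N \<lhd> G \<and> R \<subseteq> N} \<noteq> {}" by blast
  have "subgroup (normal_closure G R) G"
    unfolding normal_closure_def by (intro subgroups_Inter) (use ne normal_imp_subgroup in blast)+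
  moreover have "x \<otimes>\<^bsub>G\<^esub> h \<otimes>\<^bsub>G\<^esub> inv\<^bsub>G\<^esub> x \<in> normal_closure G R"
    if "x \<in> carrier G" "h \<in> normal_closure G R" for x h
    using that normal.inv_op_closed2 unfolding normal_closure_def by fast
  ultimately show ?thesis
    unfolding normal_inv_iff by blast
qed

lemma subset_normal_closure: "R \<subseteq> normal_closure G R"
  by (auto simp: normal_closure_def)

lemma normal_closure_least: "N \<lhd> G \<Longrightarrow> R \<subseteq> N \<Longrightarrow> normal_closure G R \<subseteq> N"
  by (auto simp: normal_closure_def)

text \<open>This is the canonical projection of the free group onto the one-relator group.\<close>

definition one_relator_class :: "'a set \<Rightarrow> 'a letter list \<Rightarrow> 'a letter list \<Rightarrow> 'a letter list set" where
  "one_relator_class S r w = normal_closure (free_group S) {r} #>\<^bsub>free_group S\<^esub> w"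

lemma group_one_relator_group:
  "r \<in> carrier (free_group S) \<Longrightarrow> group (one_relator_group S r)"
  unfolding one_relator_group_def
  by (intro normal.factorgroup_is_group normal_closure_normal group_free_group) simp

lemma one_relator_class_hom:
  "r \<in> carrier (free_group S) \<Longrightarrow>
     one_relator_class S r \<in> hom (free_group S) (one_relator_group S r)"
  unfolding one_relator_group_def one_relator_class_def
  by (intro normal.r_coset_hom_Mod normal_closure_normal group_free_group) simp

lemma one_relator_class_eq_one_iff:
  assumes "r \<in> carrier (free_group S)" "w \<in> carrier (free_group S)"
  shows "one_relator_class S r w = \<one>\<^bsub>one_relator_group S r\<^esub> \<longleftrightarrow>
    w \<in> normal_closure (free_group S) {r}"
proof -
  interpret F: group "free_group S" by (rule group_free_group)
  have "subgroup (normal_closure (free_group S) {r}) (free_group S)"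
    using normal_closure_normal[OF F.is_group, of "{r}"] assms
    by (simp add: normal_imp_subgroup)
  then show ?thesis
    using assms F.coset_join1[of "normal_closure (free_group S) {r}" w]
      F.coset_join2[of w "normal_closure (free_group S) {r}"]
    by (auto simp: one_relator_class_def one_relator_group_def FactGroup_def subgroup.subset)
qed

text \<open>The substitutions induce homomorphisms in both directions that are mutually inverse on
  generators. The isomorphism itself comes from the first isomorphism theorem applied to
  \<open>h\<close>, which needs only its kernel and its surjectivity.\<close>

lemma one_relator_group_isoI:
  fixes S :: "'a set" and f f' :: "'a \<Rightarrow> 'a letter list"
  defines "\<phi> \<equiv> group.word_eval (free_group S) f" and "\<phi>' \<equiv> group.word_eval (free_group S) f'"
  assumes r: "r \<in> carrier (free_group S)" "r' \<in> carrier (free_group S)"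
    and f: "f \<in> S \<rightarrow> carrier (free_group S)" "f' \<in> S \<rightarrow> carrier (free_group S)"
    and relator: "one_relator_class S r' (\<phi> r) = \<one>\<^bsub>one_relator_group S r'\<^esub>"
      "one_relator_class S r (\<phi>' r') = \<one>\<^bsub>one_relator_group S r\<^esub>"
    and inverse: "\<And>x. x \<in> S \<Longrightarrow> one_relator_class S r (\<phi>' (f x)) = one_relator_class S r [Gen x]"
      "\<And>x. x \<in> S \<Longrightarrow> one_relator_class S r' (\<phi> (f' x)) = one_relator_class S r' [Gen x]"
  shows "one_relator_group S r \<cong> one_relator_group S r'"
proof -
  let ?F = "free_group S" and ?Q = "one_relator_group S r" and ?Q' = "one_relator_group S r'"
  let ?N = "normal_closure ?F {r}" and ?N' = "normal_closure ?F {r'}"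
  interpret F: group ?F by (rule group_free_group)
  interpret Q: group ?Q by (rule group_one_relator_group[OF r(1)])
  interpret Q': group ?Q' by (rule group_one_relator_group[OF r(2)])
  have hom: "\<phi> \<in> hom ?F ?F" "\<phi>' \<in> hom ?F ?F"
    unfolding \<phi>_def \<phi>'_def using f by (auto intro: F.word_eval_hom)
  have gen: "\<phi> [Gen x] = f x" "\<phi>' [Gen x] = f' x" if "x \<in> S" for x
    using f that by (auto simp: \<phi>_def \<phi>'_def Pi_iff)
  define h where "h = one_relator_class S r' \<circ> \<phi>"
  define h' where "h' = one_relator_class S r \<circ> \<phi>'"
  have h_hom: "h \<in> hom ?F ?Q'" and h'_hom: "h' \<in> hom ?F ?Q"
    unfolding h_def h'_def using hom one_relator_class_hom r by (blast intro: hom_compose)+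
  interpret h: group_hom ?F ?Q' h using h_hom by unfold_locales
  interpret h': group_hom ?F ?Q h' using h'_hom by unfold_locales
  have closed: "\<phi> w \<in> carrier ?F" "\<phi>' w \<in> carrier ?F" if "w \<in> carrier ?F" for w
    using hom that by (auto simp: hom_def)
  have word_eval_cong: "group.word_eval H g w = group.word_eval H g' w"
    if "group H" "w \<in> carrier ?F" "\<And>x. x \<in> S \<Longrightarrow> g x = g' x" for H :: "'a letter list set monoid" and g g' w
  proof -
    interpret H: group H by fact
    have "w \<in> lists (Gen ` S \<union> Inv ` S)"
      using that by (simp add: carrier_free_group)
    then show ?thesis
      using that(3) by (induction w) auto
  qed
  \<comment> \<open>The composite and the projection agree on generators, hence on all
    words.\<close>
  have h'_\<phi>: "h' (\<phi> w) = one_relator_class S r w" if "w \<in> carrier ?F" for w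
  proof -
    have "h' \<circ> \<phi> \<in> hom ?F ?Q" using hom h'_hom by (blast intro: hom_compose)
    from Q.hom_free_group_eq_word_eval[OF this that] show ?thesis
      using Q.hom_free_group_eq_word_eval[OF one_relator_class_hom[OF r(1)] that]
        word_eval_cong[OF Q.is_group that, of "\<lambda>x. (h' \<circ> \<phi>) [Gen x]" "\<lambda>x. one_relator_class S r [Gen x]"]
        inverse(1) gen by (simp add: h'_def)
  qed
  have h_\<phi>': "h (\<phi>' w) = one_relator_class S r' w" if "w \<in> carrier ?F" for w
  proof -
    have "h \<circ> \<phi>' \<in> hom ?F ?Q'" using hom h_hom by (blast intro: hom_compose)
    from Q'.hom_free_group_eq_word_eval[OF this that] show ?thesis
      using Q'.hom_free_group_eq_word_eval[OF one_relator_class_hom[OF r(2)] that]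
        word_eval_cong[OF Q'.is_group that, of "\<lambda>x. (h \<circ> \<phi>') [Gen x]" "\<lambda>x. one_relator_class S r' [Gen x]"]
        inverse(2) gen by (simp add: h_def)
  qed
  have N_h: "?N \<subseteq> kernel ?F ?Q' h"
    using h.normal_kernel relator(1) r(1)
    by (intro normal_closure_least) (auto simp: kernel_def h_def)
  have N'_h': "?N' \<subseteq> kernel ?F ?Q h'"
    using h'.normal_kernel relator(2) r(2)
    by (intro normal_closure_least) (auto simp: kernel_def h'_def)
  \<comment> \<open>If \<open>h\<close> kills \<open>w\<close>, then \<open>\<phi> w\<close> lies in
    \<open>?N'\<close>, which \<open>h'\<close> kills; since \<open>h'\<close> after
    \<open>\<phi>\<close> is the projection, \<open>w\<close> lies in \<open>?N\<close>.\<close>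
  have "kernel ?F ?Q' h \<subseteq> ?N"
  proof
    fix w assume "w \<in> kernel ?F ?Q' h"
    then have w: "w \<in> carrier ?F" "one_relator_class S r' (\<phi> w) = \<one>\<^bsub>?Q'\<^esub>"
      by (auto simp: kernel_def h_def)
    then have "\<phi> w \<in> ?N'"
      using one_relator_class_eq_one_iff[OF r(2) closed(1)] by blast
    with N'_h' have "h' (\<phi> w) = \<one>\<^bsub>?Q\<^esub>" by (auto simp: kernel_def)
    then show "w \<in> ?N"
      using h'_\<phi> w(1) one_relator_class_eq_one_iff[OF r(1)] by simp
  qed
  with N_h have ker: "kernel ?F ?Q' h = ?N" by blast
  \<comment> \<open>The class of \<open>w\<close> is the image under \<open>h\<close> of
    \<open>\<phi>' w\<close>.\<close>
  have "carrier ?Q' \<subseteq> h ` carrier ?F"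
  proof
    fix X assume "X \<in> carrier ?Q'"
    then obtain w where "w \<in> carrier ?F" "X = one_relator_class S r' w"
      by (auto simp: one_relator_group_def one_relator_class_def FactGroup_def RCOSETS_def)
    with h_\<phi>' closed(2) show "X \<in> h ` carrier ?F" by (metis image_eqI)
  qed
  then have "?F Mod kernel ?F ?Q' h \<cong> ?Q'"
    by (intro h.FactGroup_iso) auto
  then have "?F Mod ?N \<cong> ?Q'"
    by (simp only: ker)
  then show ?thesis
    unfolding one_relator_group_def .
qed


section \<open>Counting turns\<close>

fun sum_turns :: "('a letter \<Rightarrow> 'a letter \<Rightarrow> int) \<Rightarrow> 'a letter list \<Rightarrow> int" where
  "sum_turns t [] = 0"
| "sum_turns t [x] = 0"
| "sum_turns t (x # y # w) = t x y + sum_turns t (y # w)"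

lemma sum_turns_append:
  "sum_turns t (u @ v) =
     sum_turns t u + sum_turns t v + (if u = [] \<or> v = [] then 0 else t (last u) (hd v))"
proof (induction t u rule: sum_turns.induct)
  case (2 t x)
  then show ?case by (cases v) auto
qed auto

lemma sum_turns_inverse_word:
  assumes "\<And>x y. t (inv_letter y) (inv_letter x) = - t x y"
  shows "sum_turns t (inverse_word w) = - sum_turns t w"
proof (induction w)
  case (Cons x w)
  have "sum_turns t (x # w) = sum_turns t w + (if w = [] then 0 else t x (hd w))"
    using sum_turns_append[of t "[x]" w] by simp
  moreover have "inverse_word (x # w) = inverse_word w @ [inv_letter x]"
    by (simp add: inverse_word_def)
  ultimately show ?case
    using Cons assms[of "hd w" x] by (simp add: sum_turns_append)
qed (simp add: inverse_word_def)

text \<open>\<open>q\<close> is the part of \<open>u\<close> that cancels against \<open>v\<close>;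
  it is found by prepending the letters of \<open>u\<close> to \<open>v\<close> one at a
  time.\<close>

lemma reduce_append_tripod:
  assumes "reduced u" "reduced v"
  shows "\<exists>p q s. u = p @ q \<and> v = inverse_word q @ s \<and> reduce (u @ v) = p @ s"
  using assms(1)
proof (induction u)
  case Nil
  with assms show ?case
    by (intro exI[of _ "[]"] exI[of _ v]) (simp add: reduce_reduced inverse_word_def)
next
  case (Cons x u)
  then have "reduced u" by (simp add: reduced_Cons)
  from Cons.IH[OF this] obtain p q s
    where IH: "u = p @ q" "v = inverse_word q @ s" "reduce (u @ v) = p @ s"
    by blast
  then have red: "reduce ((x # u) @ v) = cancel_Cons x (p @ s)"
    by (simp add: reduce_def)
  show ?case
  \<comment> \<open>The new letter cancels only if no later letter of \<open>u\<close> survives and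
    \<open>s\<close> starts with its inverse; it then extends \<open>q\<close> and shortens
    \<open>s\<close>. Otherwise it extends \<open>p\<close>.\<close>
  proof (cases "p = [] \<and> s \<noteq> [] \<and> hd s = inv_letter x")
    case True
    with IH red show ?thesis
      by (intro exI[of _ "[]"] exI[of _ "x # q"] exI[of _ "tl s"])
        (cases s; auto simp: inverse_word_def)
  next
    case False
    have "cancel_Cons x (p @ s) = x # p @ s"
      using False Cons.prems IH(1) by (cases p; cases s) (auto simp: reduced_Cons)
    with IH red show ?thesis
      by (intro exI[of _ "x # p"] exI[of _ q] exI[of _ s]) auto
  qed
qed

lemma reduced_append_last_hd:
  "reduced (u @ v) \<Longrightarrow> u \<noteq> [] \<Longrightarrow> v \<noteq> [] \<Longrightarrow> hd v \<noteq> inv_letter (last u)"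
  by (auto simp: reduced_def successively_append_iff)

text \<open>
  Writing \<open>u = p q\<close> and \<open>v = q\<inverse> s\<close>, the words \<open>p q\<close>, \<open>q\<inverse> s\<close> and \<open>p s\<close> run along the three pairs
  of legs of a tripod, and the defect only sees the three turns at its centre.
\<close>

lemma sum_turns_reduce_append:
  assumes odd: "\<And>x y. t (inv_letter y) (inv_letter x) = - t x y"
    and bound: "\<And>x y. \<bar>t x y\<bar> \<le> d"
    and tripod: "\<And>x y z. y \<noteq> inv_letter x \<Longrightarrow> z \<noteq> inv_letter x \<Longrightarrow> z \<noteq> y \<Longrightarrow>
      \<bar>t x z - t x y - t (inv_letter y) z\<bar> \<le> d"
    and "reduced u" "reduced v"
  shows "\<bar>sum_turns t (reduce (u @ v)) - sum_turns t u - sum_turns t v\<bar> \<le> d"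
proof -
  obtain p q s where pqs: "u = p @ q" "v = inverse_word q @ s" "reduce (u @ v) = p @ s"
    using reduce_append_tripod[OF assms(4,5)] by blast
  have d: "d \<ge> 0" using bound[of undefined undefined] by linarith
  show ?thesis
  proof (cases "q = []")
    case True
    with pqs d bound show ?thesis
      by (auto simp: sum_turns_append inverse_word_def)
  next
    case False
    have ps: "hd s \<noteq> inv_letter (last p)" if "p \<noteq> []" "s \<noteq> []"
      using reduced_append_last_hd[of p s] that pqs(3) reduced_reduce[of "u @ v"] by simp
    have pq: "hd q \<noteq> inv_letter (last p)" if "p \<noteq> []"
      using reduced_append_last_hd[of p q] that False pqs(1) assms(4) by simp
    have qs: "hd s \<noteq> hd q" if "s \<noteq> []"
      using reduced_append_last_hd[of "inverse_word q" s] that False pqs(2) assms(5) by simp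
    \<comment> \<open>Turns inside \<open>q\<close> cancel against those inside its inverse by
      oddness, and turns inside \<open>p\<close> and \<open>s\<close> occur on both sides.\<close>
    have "sum_turns t (reduce (u @ v)) - sum_turns t u - sum_turns t v =
        (if p = [] \<or> s = [] then 0 else t (last p) (hd s))
        - (if p = [] then 0 else t (last p) (hd q))
        - (if s = [] then 0 else t (inv_letter (hd q)) (hd s))"
      using False pqs sum_turns_inverse_word[of t q, OF odd]
      by (simp add: sum_turns_append)
    then show ?thesis
      using d bound[of "last p" "hd q"] bound[of "inv_letter (hd q)" "hd s"]
        tripod[OF pq ps qs] by (auto split: if_splits)
  qed
qed

lemma pow_free_group:
  assumes "w \<in> carrier (free_group S)" "cyclically_reduced w"
  shows "w [^]\<^bsub>free_group S\<^esub> (n::nat) = concat (replicate n w)"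
proof (cases "w = []")
  case True
  interpret F: group "free_group S" by (rule group_free_group)
  from True show ?thesis
    using F.nat_pow_one[of n] by (simp add: one_free_group concat_replicate_trivial)
next
  case False
  interpret F: group "free_group S" by (rule group_free_group)
  have red: "reduced (concat (replicate n w))" for n
  proof (induction n)
    case (Suc n)
    have "hd (concat (replicate n w)) = hd w" if "concat (replicate n w) \<noteq> []"
      using that False by (cases n) auto
    with Suc show ?case
      using assms(2) by (auto simp: cyclically_reduced_def reduced_def successively_append_iff)
  qed simp
  show ?thesis
  proof (induction n)
    case 0
    then show ?case by (simp add: one_free_group)
  next
    case (Suc n)
    then have "w [^]\<^bsub>free_group S\<^esub> Suc n = reduce (w @ concat (replicate n w))"
      using F.nat_pow_Suc2[OF assms(1), of n] by (simp add: mult_free_group)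
    with red[of "Suc n"] show ?case by (simp add: reduce_reduced)
  qed
qed

text \<open>The seam between consecutive copies has weight zero by hypothesis, so the growth is
  exactly linear.\<close>

lemma sum_turns_concat_replicate:
  assumes "w \<noteq> []" "t (last w) (hd w) = 0"
  shows "sum_turns t (concat (replicate n w)) = int n * sum_turns t w"
proof (induction n)
  case (Suc n)
  have "hd (concat (replicate n w)) = hd w" if "concat (replicate n w) \<noteq> []"
    using that assms(1) by (cases n) auto
  with Suc assms show ?case
    by (auto simp: sum_turns_append algebra_simps)
qed simp

section \<open>A turn weight giving a quasimorphism of defect one\<close>

definition turn_weight :: "'a \<Rightarrow> 'a \<Rightarrow> 'a letter \<Rightarrow> 'a letter \<Rightarrow> int" where
  "turn_weight a b x y =
     (if x = Inv a \<and> y = Gen b \<or> x = Gen b \<and> y = Inv a then 1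
      else if x = Gen a \<and> y = Inv b \<or> x = Inv b \<and> y = Gen a then -1 else 0)"

lemma turn_weight_odd:
  assumes "a \<noteq> b"
  shows "turn_weight a b (inv_letter y) (inv_letter x) = - turn_weight a b x y"
  using assms by (cases x; cases y) (simp_all add: turn_weight_def)

lemma turn_weight_bound: "\<bar>turn_weight a b x y\<bar> \<le> 1"
  by (simp add: turn_weight_def)

text \<open>Each letter over \<open>a\<close> and \<open>b\<close> has a single successor of nonzero
  weight: the pairs are \<open>aB\<close>, \<open>Ba\<close>, \<open>Ab\<close> and
  \<open>bA\<close>.\<close>

lemma turn_weight_unique:
  assumes "a \<noteq> b" "turn_weight a b x y \<noteq> 0" "turn_weight a b x z \<noteq> 0"
  shows "y = z"
proof -
  have "(x, v) \<in> {(Inv a, Gen b), (Gen b, Inv a), (Gen a, Inv b), (Inv b, Gen a)}"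
    if "turn_weight a b x v \<noteq> 0" for v
    using that by (rule contrapos_np) (auto simp: turn_weight_def)
  from this[OF assms(2)] this[OF assms(3)] assms(1) show ?thesis by auto
qed

text \<open>Any two of the three turns, reversed where necessary by oddness, start with the same
  letter and continue with different ones. Uniqueness of the weighted successor then leaves at most
  one of them nonzero.\<close>

lemma turn_weight_tripod:
  assumes "a \<noteq> b" "y \<noteq> inv_letter x" "z \<noteq> inv_letter x" "z \<noteq> y"
  shows "\<bar>turn_weight a b x z - turn_weight a b x y - turn_weight a b (inv_letter y) z\<bar> \<le> 1"
proof -
  let ?t = "turn_weight a b"
  have "?t x z = 0 \<or> ?t x y = 0"
    using turn_weight_unique[of a b x y z] assms by blast
  moreover have "?t x y = 0 \<or> ?t (inv_letter y) z = 0"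
    using turn_weight_unique[of a b "inv_letter y" "inv_letter x" z] turn_weight_odd[OF assms(1), of y x] assms
    by fastforce
  moreover have "?t x z = 0 \<or> ?t (inv_letter y) z = 0"
    using turn_weight_unique[of a b "inv_letter z" "inv_letter x" y] turn_weight_odd[OF assms(1), of z x]
      turn_weight_odd[OF assms(1), of z "inv_letter y"] assms by fastforce
  ultimately show ?thesis
    using turn_weight_bound[of a b x z] turn_weight_bound[of a b x y]
      turn_weight_bound[of a b "inv_letter y" z] by linarith
qed

text \<open>The criterion \<open>scl_eqI\<close> applies with defect 1 and no error in the lower
  bound, since the counting function takes the value \<open>4 \<sigma> n\<close> exactly on the
  power \<open>n\<close> of \<open>w\<close>.\<close>

lemma scl_eq_of_sum_turns:
  fixes \<sigma> B :: real
  assumes "a \<noteq> b" and w: "w \<in> carrier (free_group S)" "cyclically_reduced w" "w \<noteq> []"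
    and turns: "turn_weight a b (last w) (hd w) = 0" "sum_turns (turn_weight a b) w = 4 * \<sigma>"
    and upper: "\<And>n. w [^]\<^bsub>free_group S\<^esub> n \<in> group.commutator_products (free_group S) (N n)"
      "\<And>n. real (N n) \<le> \<sigma> * real n + B"
  shows "scl (free_group S) w = \<sigma>"
proof -
  interpret F: group "free_group S" by (rule group_free_group)
  let ?t = "turn_weight a b"
  show ?thesis
  proof (rule F.scl_eqI[where f = "sum_turns ?t" and d = 1 and A = 0, OF _ _ _ _ upper])
    fix u v assume "u \<in> carrier (free_group S)" "v \<in> carrier (free_group S)"
    then show "\<bar>sum_turns ?t (u \<otimes>\<^bsub>free_group S\<^esub> v) - sum_turns ?t u - sum_turns ?t v\<bar> \<le> 1"
      unfolding mult_free_group
      by (intro sum_turns_reduce_append turn_weight_odd turn_weight_tripod assms(1))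
        (auto simp: carrier_free_group intro: turn_weight_bound)
  next
    fix u assume "u \<in> carrier (free_group S)"
    then show "sum_turns ?t (inv\<^bsub>free_group S\<^esub> u) = - sum_turns ?t u"
      by (simp add: inv_free_group sum_turns_inverse_word turn_weight_odd[OF assms(1)])
  next
    fix n :: nat
    show "4 * real_of_int 1 * \<sigma> * real n - 0 \<le> sum_turns ?t (w [^]\<^bsub>free_group S\<^esub> n)"
      using sum_turns_concat_replicate[of w ?t n] w(3) turns
      by (simp add: pow_free_group[OF w(1,2)])
  qed simp
qed


section \<open>The two relators\<close>

definition relator :: "'a \<Rightarrow> 'a \<Rightarrow> 'a letter list" where
  "relator a b =
     [Gen a, Gen a, Gen b, Inv a, Inv b, Gen a, Gen b, Inv a, Inv b, Inv b, Inv a, Gen b, Gen a,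
      Gen a, Gen b, Inv a, Inv b, Inv b, Inv a, Gen b]"

definition relator' :: "'a \<Rightarrow> 'a \<Rightarrow> 'a letter list" where
  "relator' a b =
     [Gen a, Gen a, Gen b, Inv a, Inv b, Gen a, Gen b, Inv a, Inv b, Gen a, Gen b, Inv a, Inv b,
      Inv b, Inv a, Gen b, Gen a, Inv b, Inv a, Gen b]"

text \<open>
  With \<open>c = [a, b]\<close> and \<open>p = [B, A]\<close>, the substitution \<open>subst_word\<close> is \<open>a \<mapsto> p a\<close>, \<open>b \<mapsto> b p\<inverse>\<close> and
  \<open>subst_word'\<close> is \<open>a \<mapsto> c\<^sup>3 a\<close>, \<open>b \<mapsto> b c\<^sup>-\<^sup>3\<close>; both fix \<open>b a\<close>.
\<close>

definition subst_word :: "'a \<Rightarrow> 'a \<Rightarrow> 'a \<Rightarrow> 'a letter list" where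
  "subst_word a b x =
     (if x = a then [Inv b, Inv a, Gen b, Gen a, Gen a]
      else [Gen b, Inv a, Inv b, Gen a, Gen b])"

definition subst_word' :: "'a \<Rightarrow> 'a \<Rightarrow> 'a \<Rightarrow> 'a letter list" where
  "subst_word' a b x =
     (if x = a
      then [Gen a, Gen b, Inv a, Inv b, Gen a, Gen b, Inv a, Inv b, Gen a, Gen b, Inv a, Inv b,
            Gen a]
      else [Gen b, Gen b, Gen a, Inv b, Inv a, Gen b, Gen a, Inv b, Inv a, Gen b, Gen a, Inv b,
            Inv a])"

section \<open>Passing between the two relations in an arbitrary group\<close>

context group
begin

text \<open>Everything reduces to powers of \<open>e\<close> and conjugation by
  \<open>s = b a\<close>, which the substitution fixes. Here \<open>c = e^-2\<close>,
  \<open>p = e^3\<close> and \<open>c' = p c c = e^-1\<close>; conjugation by \<open>s^-1\<close>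
  takes \<open>c^-1 = e^2\<close> to \<open>p = e^3\<close>, hence \<open>p'^2 = e^3\<close>. The
  second conclusion lets the reverse substitution recover \<open>a\<close> and
  \<open>b\<close>.\<close>

lemma relators_transfer:
  assumes "a \<in> carrier G" "b \<in> carrier G"
  defines "c \<equiv> commutator a b" and "p \<equiv> commutator (inv b) (inv a)"
  assumes rel: "c \<otimes> c \<otimes> p \<otimes> c \<otimes> p = \<one>"
  defines "a' \<equiv> p \<otimes> a" and "b' \<equiv> b \<otimes> inv p"
  defines "c' \<equiv> commutator a' b'" and "p' \<equiv> commutator (inv b') (inv a')"
  shows "c' \<otimes> c' \<otimes> c' \<otimes> p' \<otimes> p' = \<one>" "inv (c' \<otimes> c' \<otimes> c') = p"
proof -
  define s where "s = b \<otimes> a"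
  define e where "e = c \<otimes> p"
  have G: "c \<in> carrier G" "p \<in> carrier G" "s \<in> carrier G" "e \<in> carrier G"
    using assms(1,2) by (auto simp: c_def p_def s_def e_def)
  have "c \<otimes> (e \<otimes> e) = \<one>"
    using rel G by (simp add: e_def m_assoc)
  then have c: "c = inv (e \<otimes> e)"
    using G by (simp add: inv_equality)
  have p: "p = e \<otimes> e \<otimes> e"
    using G inv_mult_cancel(1)[of c p] by (simp flip: e_def) (simp add: c word_simps)
  have s: "inv s \<otimes> inv c \<otimes> s = p"
    using assms(1,2) by (simp add: c_def p_def s_def commutator_def word_simps)
  have "c' = p \<otimes> c \<otimes> c"
    using assms(1,2) by (simp add: c'_def a'_def b'_def c_def p_def commutator_def word_simps)
  also have "\<dots> = inv e"
    using G by (simp add: p c word_simps)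
  finally have c': "c' = inv e" .
  have "p' = inv s \<otimes> inv c' \<otimes> s"
    using assms(1,2) by (simp add: c'_def p'_def a'_def b'_def s_def p_def commutator_def word_simps)
  then have "p' \<otimes> p' = inv s \<otimes> (e \<otimes> e) \<otimes> s"
    using G by (simp add: c' word_simps)
  also have "\<dots> = e \<otimes> e \<otimes> e"
    using s G by (simp add: c p)
  finally have p': "p' \<otimes> p' = e \<otimes> e \<otimes> e" .
  have "p' \<in> carrier G"
    using assms(1,2) G by (simp add: p'_def a'_def b'_def)
  then have "c' \<otimes> c' \<otimes> c' \<otimes> p' \<otimes> p' = c' \<otimes> c' \<otimes> c' \<otimes> (p' \<otimes> p')"
    using G by (simp add: c' m_assoc)
  with G show "c' \<otimes> c' \<otimes> c' \<otimes> p' \<otimes> p' = \<one>"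
    by (simp add: c' p' word_simps)
  from G show "inv (c' \<otimes> c' \<otimes> c') = p"
    by (simp add: c' p word_simps)
qed

text \<open>Since \<open>a b = c s\<close> with \<open>s = b a\<close>, the new commutator is
  \<open>c' = c^4 s c^-3 s^-1\<close>. The relation gives \<open>c^-3 = p^2\<close>, and
  \<open>s p s^-1 = c^-1\<close>, so \<open>c' = c^2\<close> and dually
  \<open>p' = p^2\<close>.\<close>

lemma relators_transfer':
  assumes "a \<in> carrier G" "b \<in> carrier G"
  defines "c \<equiv> commutator a b" and "p \<equiv> commutator (inv b) (inv a)"
  assumes rel: "c \<otimes> c \<otimes> c \<otimes> p \<otimes> p = \<one>"
  defines "a' \<equiv> c \<otimes> c \<otimes> c \<otimes> a" and "b' \<equiv> b \<otimes> inv (c \<otimes> c \<otimes> c)"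
  defines "c' \<equiv> commutator a' b'" and "p' \<equiv> commutator (inv b') (inv a')"
  shows "c' \<otimes> c' \<otimes> p' \<otimes> c' \<otimes> p' = \<one>" "inv p' = c \<otimes> c \<otimes> c"
proof -
  define s where "s = b \<otimes> a"
  have G: "c \<in> carrier G" "p \<in> carrier G" "s \<in> carrier G"
    using assms(1,2) by (auto simp: c_def p_def s_def)
  have "c \<otimes> c \<otimes> c \<otimes> (p \<otimes> p) = \<one>"
    using rel G by (simp add: m_assoc)
  then have ccc: "c \<otimes> c \<otimes> c = inv (p \<otimes> p)"
    using G by (simp add: inv_equality)
  have s: "s \<otimes> p \<otimes> inv s = inv c"
    using assms(1,2) by (simp add: c_def p_def s_def commutator_def word_simps)
  have "c' = c \<otimes> c \<otimes> c \<otimes> c \<otimes> s \<otimes> inv (c \<otimes> c \<otimes> c) \<otimes> inv s"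
    using assms(1,2) by (simp add: c'_def a'_def b'_def c_def s_def commutator_def word_simps)
  also have "\<dots> = c \<otimes> c \<otimes> c \<otimes> c \<otimes> (s \<otimes> p \<otimes> inv s) \<otimes> (s \<otimes> p \<otimes> inv s)"
    using G by (simp add: ccc) (simp add: word_simps)
  also have "\<dots> = c \<otimes> c"
    using G by (simp add: s) (simp add: word_simps)
  finally have c': "c' = c \<otimes> c" .
  have "p' = inv s \<otimes> inv c' \<otimes> s"
    using assms(1,2) G by (simp add: c'_def p'_def a'_def b'_def s_def commutator_def word_simps)
  also have "\<dots> = inv s \<otimes> inv c \<otimes> s \<otimes> (inv s \<otimes> inv c \<otimes> s)"
    using G by (simp add: c' word_simps)
  also have "inv s \<otimes> inv c \<otimes> s = p"
    using G by (simp add: s[symmetric] word_simps)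
  finally have p': "p' = p \<otimes> p" .
  from G show "inv p' = c \<otimes> c \<otimes> c"
    by (simp add: p' ccc)
  \<comment> \<open>The word \<open>c^4 p^2 c^2 p^2\<close> is regrouped to display the given
    relator \<open>c^3 p^2\<close> twice.\<close>
  have "c' \<otimes> c' \<otimes> p' \<otimes> c' \<otimes> p' = c \<otimes> ((c \<otimes> c \<otimes> c) \<otimes> (p \<otimes> p)) \<otimes> inv c \<otimes> ((c \<otimes> c \<otimes> c) \<otimes> (p \<otimes> p))"
    using G by (simp add: c' p' word_simps)
  also have "\<dots> = \<one>"
    using G by (simp add: ccc)
  finally show "c' \<otimes> c' \<otimes> p' \<otimes> c' \<otimes> p' = \<one>" .
qed

lemma conj_eq_one_iff:
  assumes "x \<in> carrier G" "g \<in> carrier G"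
  shows "x \<otimes> g \<otimes> inv x = \<one> \<longleftrightarrow> g = \<one>"
proof
  assume "x \<otimes> g \<otimes> inv x = \<one>"
  moreover have "g = inv x \<otimes> (x \<otimes> g \<otimes> inv x) \<otimes> x"
    using assms by (simp add: word_simps)
  ultimately show "g = \<one>"
    using assms by simp
qed (use assms in simp)

context
  fixes f :: "'c \<Rightarrow> 'a" and a b :: 'c and c p :: 'a
  assumes ab: "a \<noteq> b" "f a \<in> carrier G" "f b \<in> carrier G"
  defines "c \<equiv> commutator (f a) (f b)" and "p \<equiv> commutator (inv f b) (inv f a)"
begin

lemma cp_closed: "c \<in> carrier G" "p \<in> carrier G"
  using ab by (auto simp: c_def p_def)

lemma word_eval_relator:
  "word_eval f (relator a b) = \<one> \<longleftrightarrow> c \<otimes> c \<otimes> p \<otimes> c \<otimes> p = \<one>"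
proof -
  have "word_eval f (relator a b) = f a \<otimes> (c \<otimes> c \<otimes> p \<otimes> c \<otimes> p) \<otimes> inv f a"
    using ab by (simp add: relator_def c_def p_def commutator_def word_simps)
  with ab cp_closed show ?thesis
    by (simp add: conj_eq_one_iff)
qed

lemma word_eval_relator':
  "word_eval f (relator' a b) = \<one> \<longleftrightarrow> c \<otimes> c \<otimes> c \<otimes> p \<otimes> p = \<one>"
proof -
  have "word_eval f (relator' a b) = f a \<otimes> (c \<otimes> c \<otimes> c \<otimes> p \<otimes> p) \<otimes> inv f a"
    using ab by (simp add: relator'_def c_def p_def commutator_def word_simps)
  with ab cp_closed show ?thesis
    by (simp add: conj_eq_one_iff)
qed

lemma word_eval_subst_word:
  "word_eval f (subst_word a b a) = p \<otimes> f a" "word_eval f (subst_word a b b) = f b \<otimes> inv p"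
  using ab by (simp_all add: subst_word_def p_def commutator_def word_simps)

lemma word_eval_subst_word':
  "word_eval f (subst_word' a b a) = c \<otimes> c \<otimes> c \<otimes> f a"
  "word_eval f (subst_word' a b b) = f b \<otimes> inv (c \<otimes> c \<otimes> c)"
  using ab by (simp_all add: subst_word'_def c_def commutator_def word_simps)

end

text \<open>This restates the transfer for words, ready for the case where \<open>f\<close> sends
  generators to their classes in a quotient. Substituting back recovers \<open>f\<close> because the
  cube of the new commutator is the inverse of the old \<open>p\<close>.\<close>

lemma relator_subst_word:
  fixes f :: "'c \<Rightarrow> 'a"
  assumes ab: "a \<noteq> b" "f a \<in> carrier G" "f b \<in> carrier G"
    and rel: "word_eval f (relator a b) = \<one>"
  defines "g \<equiv> \<lambda>x. word_eval f (subst_word a b x)"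
  shows "word_eval g (relator' a b) = \<one>"
    and "x \<in> {a, b} \<Longrightarrow> word_eval g (subst_word' a b x) = f x"
proof -
  have g: "g a = commutator (inv f b) (inv f a) \<otimes> f a" "g b = f b \<otimes> inv commutator (inv f b) (inv f a)"
    by (simp_all add: g_def word_eval_subst_word[OF ab])
  define p where "p = commutator (inv f b) (inv f a)"
  define q where "q = commutator (g a) (g b) \<otimes> commutator (g a) (g b) \<otimes> commutator (g a) (g b)"
  have p: "p \<in> carrier G" using ab by (simp add: p_def)
  have gc: "g a \<in> carrier G" "g b \<in> carrier G"
    using ab by (simp_all add: g)
  then have q: "q \<in> carrier G" by (simp add: q_def)
  note transfer = relators_transfer[OF ab(2,3) rel[unfolded word_eval_relator[OF ab]], folded g]
  from transfer(1) show "word_eval g (relator' a b) = \<one>"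
    by (simp add: word_eval_relator'[of a b g] ab(1) gc)
  have "inv q = p"
    using transfer(2) by (simp add: q_def p_def)
  then have "q = inv p" using q by auto
  then have "q \<otimes> (p \<otimes> f a) = f a" "f b \<otimes> inv p \<otimes> inv q = f b"
    using ab p by (simp_all add: m_assoc)
  then have "q \<otimes> g a = f a" "g b \<otimes> inv q = f b"
    by (simp_all only: g p_def)
  then show "word_eval g (subst_word' a b x) = f x" if "x \<in> {a, b}"
    using that word_eval_subst_word'[of a b g] ab(1) gc by (auto simp: q_def)
qed

lemma relator'_subst_word':
  fixes f :: "'c \<Rightarrow> 'a"
  assumes ab: "a \<noteq> b" "f a \<in> carrier G" "f b \<in> carrier G"
    and rel: "word_eval f (relator' a b) = \<one>"
  defines "g \<equiv> \<lambda>x. word_eval f (subst_word' a b x)"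
  shows "word_eval g (relator a b) = \<one>"
    and "x \<in> {a, b} \<Longrightarrow> word_eval g (subst_word a b x) = f x"
proof -
  have g: "g a = commutator (f a) (f b) \<otimes> commutator (f a) (f b) \<otimes> commutator (f a) (f b) \<otimes> f a"
    "g b = f b \<otimes> inv (commutator (f a) (f b) \<otimes> commutator (f a) (f b) \<otimes> commutator (f a) (f b))"
    by (simp_all add: g_def word_eval_subst_word'[OF ab])
  define q where "q = commutator (f a) (f b) \<otimes> commutator (f a) (f b) \<otimes> commutator (f a) (f b)"
  define p where "p = commutator (inv g b) (inv g a)"
  have q: "q \<in> carrier G" using ab by (simp add: q_def)
  have gc: "g a \<in> carrier G" "g b \<in> carrier G"
    using ab by (simp_all add: g)
  then have p: "p \<in> carrier G" by (simp add: p_def)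
  note transfer = relators_transfer'[OF ab(2,3) rel[unfolded word_eval_relator'[OF ab]], folded g]
  from transfer(1) show "word_eval g (relator a b) = \<one>"
    by (simp add: word_eval_relator[of a b g] ab(1) gc)
  have "inv p = q"
    using transfer(2) by (simp add: q_def p_def)
  then have "p = inv q" using p by auto
  then have "p \<otimes> (q \<otimes> f a) = f a" "f b \<otimes> inv q \<otimes> inv p = f b"
    using ab q by (simp_all add: m_assoc)
  then have "p \<otimes> g a = f a" "g b \<otimes> inv p = f b"
    by (simp_all only: g q_def)
  then show "word_eval g (subst_word a b x) = f x" if "x \<in> {a, b}"
    using that word_eval_subst_word[of a b g] ab(1) gc by (auto simp: p_def)
qed

end

section \<open>The isomorphism between the two one-relator groups\<close>

lemma relator_closed:
  assumes "a \<noteq> b"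
  shows "relator a b \<in> carrier (free_group {a, b})" "relator' a b \<in> carrier (free_group {a, b})"
  using assms by (simp_all add: carrier_free_group relator_def relator'_def reduced_Cons)

lemma subst_word_closed:
  assumes "a \<noteq> b"
  shows "subst_word a b \<in> {a, b} \<rightarrow> carrier (free_group {a, b})"
    "subst_word' a b \<in> {a, b} \<rightarrow> carrier (free_group {a, b})"
  using assms by (simp_all add: carrier_free_group subst_word_def subst_word'_def reduced_Cons)

lemma one_relator_groups_iso:
  assumes "a \<noteq> b"
  shows "one_relator_group {a, b} (relator a b) \<cong> one_relator_group {a, b} (relator' a b)"
proof -
  let ?S = "{a, b}"
  let ?F = "free_group ?S"
  interpret F: group ?F by (rule group_free_group)
  note r = relator_closed[OF assms] and f = subst_word_closed[OF assms]
  \<comment> \<open>Projecting a substituted word amounts to evaluating twice inside the quotient,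
    the form in which the transfer lemmas apply.\<close>
  have eval: "one_relator_class ?S u (F.word_eval g w) =
      group.word_eval (one_relator_group ?S u)
        (\<lambda>x. group.word_eval (one_relator_group ?S u) (\<lambda>x. one_relator_class ?S u [Gen x]) (g x)) w"
    (is "_ = group.word_eval ?Q ?h w")
    if "u \<in> carrier ?F" "g \<in> ?S \<rightarrow> carrier ?F" "w \<in> carrier ?F" for u g w
  proof -
    interpret Q: group ?Q by (rule group_one_relator_group[OF that(1)])
    have w: "w \<in> lists (Gen ` ?S \<union> Inv ` ?S)"
      using that(3) by (simp add: carrier_free_group)
    have "one_relator_class ?S u (g x) = ?h x" if "x \<in> ?S" for x
      using Q.hom_free_group_eq_word_eval[OF one_relator_class_hom[OF \<open>u \<in> carrier ?F\<close>]
          funcset_mem[OF \<open>g \<in> ?S \<rightarrow> carrier ?F\<close> that]] .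
    then have "Q.word_eval (\<lambda>x. one_relator_class ?S u (g x)) w = Q.word_eval ?h w"
      using w by (induction w) auto
    with F.hom_word_eval[OF Q.is_group one_relator_class_hom[OF that(1)] that(2) w] show ?thesis
      by simp
  qed
  have relation: "group.word_eval (one_relator_group ?S u) (\<lambda>x. one_relator_class ?S u [Gen x]) u =
      \<one>\<^bsub>one_relator_group ?S u\<^esub>" if "u \<in> carrier ?F" for u
    using group.hom_free_group_eq_word_eval[OF group_one_relator_group[OF that]
        one_relator_class_hom[OF that] that]
      one_relator_class_eq_one_iff[OF that that] subset_normal_closure[of "{u}" ?F] by simp
  have gen: "one_relator_class ?S u [Gen a] \<in> carrier (one_relator_group ?S u)"
      "one_relator_class ?S u [Gen b] \<in> carrier (one_relator_group ?S u)" if "u \<in> carrier ?F" for u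
    using one_relator_class_hom[OF that] by (auto simp: hom_def)
  show ?thesis
  \<comment> \<open>The substitutions cross over: \<open>subst_word'\<close> uses the relation valid
    in the target, that of \<open>relator'\<close>, to make \<open>relator\<close> trivial
    there.\<close>
  proof (rule one_relator_group_isoI[where f = "subst_word' a b" and f' = "subst_word a b", OF r f(2,1)])
    note Q' = group_one_relator_group[OF r(2)]
    note * = group.relator'_subst_word'[OF Q' assms gen[OF r(2)] relation[OF r(2)]]
    show "one_relator_class ?S (relator' a b) (F.word_eval (subst_word' a b) (relator a b)) =
        \<one>\<^bsub>one_relator_group ?S (relator' a b)\<^esub>"
      unfolding eval[OF r(2) f(2) r(1)] by (rule *(1))
    show "one_relator_class ?S (relator' a b) (F.word_eval (subst_word' a b) (subst_word a b x)) =
        one_relator_class ?S (relator' a b) [Gen x]" if "x \<in> ?S" for x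
      unfolding eval[OF r(2) f(2) funcset_mem[OF f(1) that]] by (rule *(2)[OF that])
  next
    note Q = group_one_relator_group[OF r(1)]
    note * = group.relator_subst_word[OF Q assms gen[OF r(1)] relation[OF r(1)]]
    show "one_relator_class ?S (relator a b) (F.word_eval (subst_word a b) (relator' a b)) =
        \<one>\<^bsub>one_relator_group ?S (relator a b)\<^esub>"
      unfolding eval[OF r(1) f(1) r(2)] by (rule *(1))
    show "one_relator_class ?S (relator a b) (F.word_eval (subst_word a b) (subst_word' a b x)) =
        one_relator_class ?S (relator a b) [Gen x]" if "x \<in> ?S" for x
      unfolding eval[OF r(1) f(1) funcset_mem[OF f(2) that]] by (rule *(2)[OF that])
  qed
qed

section \<open>The two words, their stable commutator lengths, and the counterexample to
  invariance\<close>

theorem theorem1: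
  fixes a b :: 'a and S :: "'a set" and r r' :: "'a letter list"
  assumes "a \<noteq> b"
    and "S = {a, b}"
    and "r = [Gen a, Gen a, Gen b, Inv a, Inv b, Gen a, Gen b, Inv a, Inv b, Inv b,
              Inv a, Gen b, Gen a, Gen a, Gen b, Inv a, Inv b, Inv b, Inv a, Gen b]"
    and "r' = [Gen a, Gen a, Gen b, Inv a, Inv b, Gen a, Gen b, Inv a, Inv b, Gen a,
               Gen b, Inv a, Inv b, Inv b, Inv a, Gen b, Gen a, Inv b, Inv a, Gen b]"
  shows "r \<in> commutator_subgroup (free_group S) - {\<one>\<^bsub>free_group S\<^esub>} \<and>
    r' \<in> commutator_subgroup (free_group S) - {\<one>\<^bsub>free_group S\<^esub>} \<and>
    cyclically_reduced r \<and> length r = 20 \<and>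
    cyclically_reduced r' \<and> length r' = 20 \<and>
    one_relator_group S r \<cong> one_relator_group S r' \<and>
    scl (free_group S) r = 1 \<and>
    scl (free_group S) r' = 1 / 2 \<and>
    \<not> (\<forall>(T :: 'a set) (T' :: 'a set).
         \<forall>u \<in> commutator_subgroup (free_group T) - {\<one>\<^bsub>free_group T\<^esub>}.
         \<forall>u' \<in> commutator_subgroup (free_group T') - {\<one>\<^bsub>free_group T'\<^esub>}.
           one_relator_group T u \<cong> one_relator_group T' u' \<longrightarrow>
           scl (free_group T) u = scl (free_group T') u')"
proof -
  let ?F = "free_group S"
  interpret F: group ?F by (rule group_free_group)
  have carrier: "w \<in> carrier ?F \<longleftrightarrow> set w \<subseteq> {Gen a, Inv a, Gen b, Inv b} \<and> reduced w" for w
    by (auto simp: carrier_free_group assms(2))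
  have r: "r \<in> carrier ?F" "r' \<in> carrier ?F"
    using assms(1) by (simp_all add: carrier assms(3,4) reduced_Cons)
  have cyc: "cyclically_reduced r" "cyclically_reduced r'"
    using assms(1) by (simp_all add: assms(3,4) cyclically_reduced_def reduced_Cons)
  have ab: "[Gen a] \<in> carrier ?F" "[Gen b] \<in> carrier ?F"
    by (simp_all add: assms(2))
  \<comment> \<open>Commutators of explicit words become free reductions, so the identities below
    are checked by computation.\<close>
  have comm: "F.commutator u v = reduce (u @ v @ inverse_word u @ inverse_word v)"
    if "u \<in> carrier ?F" "v \<in> carrier ?F" for u v
    using that by (simp add: F.commutator_def mult_free_group inv_free_group
        reduce_append_reduce_left)

  let ?c = "F.commutator [Gen a] [Gen b]"
  let ?p = "F.commutator [Inv b] [Inv a]"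
  have AB: "[Inv a] \<in> carrier ?F" "[Inv b] \<in> carrier ?F"
    by (simp_all add: carrier reduced_Cons)
  have c: "?c = [Gen a, Gen b, Inv a, Inv b]" and p: "?p = [Inv b, Inv a, Gen b, Gen a]"
    using assms(1) by (simp_all add: comm[OF ab] comm[OF AB(2,1)] inverse_word_def reduce_def)
  have r_eq: "r = [Gen a] \<otimes>\<^bsub>?F\<^esub> (?c \<otimes>\<^bsub>?F\<^esub> (?c \<otimes>\<^bsub>?F\<^esub> (?p \<otimes>\<^bsub>?F\<^esub> (?c \<otimes>\<^bsub>?F\<^esub> ?p))))
      \<otimes>\<^bsub>?F\<^esub> inv\<^bsub>?F\<^esub> [Gen a]"
    using assms(1)
    by (simp add: c p assms(3) mult_free_group inv_free_group[OF ab(1)] inverse_word_def reduce_def)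
  \<comment> \<open>The five factors \<open>c\<close>, \<open>c\<close>, \<open>p\<close>,
    \<open>c\<close>, \<open>p\<close> give a crude bound that enters only the additive
    constant.\<close>
  have "?c \<otimes>\<^bsub>?F\<^esub> (?c \<otimes>\<^bsub>?F\<^esub> (?p \<otimes>\<^bsub>?F\<^esub> (?c \<otimes>\<^bsub>?F\<^esub> ?p)))
      \<in> F.commutator_products (1 + (1 + (1 + (1 + 1))))" (is "_ \<in> F.commutator_products ?five")
    using ab AB by (intro F.mult_commutator_products F.commutator_in_commutator_products)
  then have "r \<in> F.commutator_products ?five"
    unfolding r_eq by (rule F.conj_commutator_products[OF _ ab(1)])
  then have r_comm: "r \<in> F.commutator_products 5" by (simp add: eval_nat_numeral)

  \<comment> \<open>Up to conjugation by \<open>a\<close>, these are \<open>ab\<close> and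
    \<open>s^-1 c^2 b\<close> with \<open>s = ba\<close>. As \<open>ab s^-1 = c\<close> and
    \<open>p = s^-1 c^-1 s\<close>, their commutator is
    \<open>c^3 s^-1 c^-2 s = c^3 p^2\<close>.\<close>
  let ?x = "[Gen a, Gen a, Gen b, Inv a]"
  let ?y = "[Inv b, Gen a, Gen b, Inv a, Inv b, Gen a, Gen b, Inv a, Inv a]"
  have xy: "?x \<in> carrier ?F" "?y \<in> carrier ?F"
    using assms(1) by (simp_all add: carrier reduced_Cons)
  have r'_eq: "r' = F.commutator ?x ?y"
    using assms(1) by (simp add: comm[OF xy] inverse_word_def reduce_def assms(4))

  text \<open>
    The words below are read off from a gluing of two copies of \<open>r\<close> to a surface of genus two, which
    was found by computer search.
  \<close>
  let ?h = "[Inv b, Inv a]"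
  let ?x1 = "[Gen a, Gen a, Gen b, Inv a, Inv b, Gen a, Gen b, Inv a, Inv b, Inv b, Inv a,
               Gen b, Gen a, Inv b, Inv a, Inv a]"
  let ?y1 = "[Gen a, Gen a, Gen b, Gen a, Gen b, Inv a, Inv b, Inv a, Inv b, Gen a, Gen b,
               Inv a, Inv b, Inv b, Inv a, Inv b, Inv a, Gen b, Gen a, Inv b, Inv a, Inv a]"
  let ?x2 = "[Gen a, Gen a, Gen b, Gen a, Gen b, Inv a]"
  let ?y2 = "[Inv b, Inv a, Inv b, Gen a, Gen b, Inv a, Inv a]"
  have xy12: "?x1 \<in> carrier ?F" "?y1 \<in> carrier ?F" "?x2 \<in> carrier ?F" "?y2 \<in> carrier ?F"
      "?h \<in> carrier ?F"
    using assms(1) by (simp_all add: carrier reduced_Cons)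
  have two_copies: "r \<otimes>\<^bsub>?F\<^esub> (?h \<otimes>\<^bsub>?F\<^esub> r \<otimes>\<^bsub>?F\<^esub> inv\<^bsub>?F\<^esub> ?h) =
      F.commutator ?x1 ?y1 \<otimes>\<^bsub>?F\<^esub> F.commutator ?x2 ?y2"
    using assms(1)
    by (simp add: comm xy12 mult_free_group inv_free_group inverse_word_def reduce_def assms(3))

  \<comment> \<open>The constant 8 is 3 + 5. Five turns of \<open>r\<close> have weight 1 and one
    has weight -1, so the sum is 4; the seam \<open>ba\<close> has weight 0.\<close>
  have scl_r: "scl ?F r = 1"
  proof (rule scl_eq_of_sum_turns[OF assms(1) r(1) cyc(1), where B = 8])
    show "r [^]\<^bsub>?F\<^esub> n \<in> F.commutator_products (n + 3 + 5)" for n :: nat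
      by (rule F.pow_commutator_products_of_conj_eq[OF r(1) xy12(5,1-4) two_copies r_comm])
  qed (use assms(1) in \<open>simp_all add: assms(3) turn_weight_def\<close>)
  \<comment> \<open>Here five turns have weight 1 and three have weight -1, so the sum is 2,
    matching the bound for powers of a single commutator.\<close>
  have scl_r': "scl ?F r' = 1 / 2"
  proof (rule scl_eq_of_sum_turns[OF assms(1) r(2) cyc(2), where B = 1])
    show "r' [^]\<^bsub>?F\<^esub> n \<in> F.commutator_products (n div 2 + 1)" for n :: nat
      unfolding r'_eq by (rule F.pow_commutator_commutator_products[OF xy])
  qed (use assms(1) in \<open>simp_all add: assms(4) turn_weight_def\<close>)
  have derived: "r \<in> commutator_subgroup ?F - {\<one>\<^bsub>?F\<^esub>}"
      "r' \<in> commutator_subgroup ?F - {\<one>\<^bsub>?F\<^esub>}"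
    using r_comm F.commutator_in_commutator_products[OF xy, folded r'_eq]
      F.commutator_products_subset_commutator_subgroup
    by (auto simp: one_free_group assms(3,4))
  have iso: "one_relator_group S r \<cong> one_relator_group S r'"
    using one_relator_groups_iso[OF assms(1)] by (simp add: assms(2-4) relator_def relator'_def)
  have "length r = 20" "length r' = 20"
    by (simp_all add: assms(3,4))
  \<comment> \<open>Taking \<open>T = T' = S\<close> with these two words refutes
    invariance.\<close>
  moreover have "scl ?F r \<noteq> scl ?F r'"
    by (simp add: scl_r scl_r')
  ultimately show ?thesis
    using derived cyc iso scl_r scl_r' by blast
qed

end
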